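(* Let $r\geq 2$ and $k\geq 2$ be integers, let $d=rk$, and let $f:\overline{\mathbb{C}}\to\overline{\mathbb{C}}$ be a rational map of degree $d$ with exactly $3$ branching points, whose branching datum is $$\{\mu_1=[\alpha_1,\ldots,\alpha_A],\ \mu_2=[rx_1,\ldots,rx_B],\ \mu_3=[ry_1,\ldots,ry_C]\},$$ where the $\alpha_i$, $x_i$, $y_i$ are positive integers. If $A=r$, then $\mu_1=[k,\ldots,k]$.
   Context: $\overline{\mathbb{C}}=\mathbb{C}\cup\{\infty\}$ is the Riemann sphere. Square brackets denote unordered lists with repetitions (multisets). For a non-constant rational map $h:\overline{\mathbb{C}}\to\overline{\mathbb{C}}$ of degree $d$ and $x\in\overline{\mathbb{C}}$, let $\mu(x)$ be the partition of $d$ formed by the local degrees (multiplicities) of $h$ at the points of $h^{-1}(x)$. The branching points of $h$ are the points $x$ of the target for which $\mu(x)$ is not the trivial partition $[1,\ldots,1]$, and the branching datum of $h$ is the collection (with repetitions) of the partitions $\mu(x)$ over all branching points $x$. *)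

theory Defs
  imports
    "HOL-Complex_Analysis.Complex_Analysis"
    "HOL-Computational_Algebra.Computational_Algebra"
    "HOL-Library.Multiset"
begin

text \<open>The point at infinity is \<open>None\<close>, as in the library's one-point compactification.\<close>

type_synonym riemann_sphere = "complex option"

fun sphere_inverse :: "riemann_sphere \<Rightarrow> riemann_sphere" where
  "sphere_inverse None = Some 0"
| "sphere_inverse (Some z) = (if z = 0 then None else Some (1 / z))"

text \<open>
  The map induced by \<open>p/q\<close>, for coprime \<open>p\<close> and \<open>q\<close>. At infinity one compares the coefficients
  of degree \<open>max (degree p) (degree q)\<close>, which do not both vanish.
\<close>

fun rational_map :: "complex poly \<Rightarrow> complex poly \<Rightarrow> riemann_sphere \<Rightarrow> riemann_sphere" where
  "rational_map p q (Some z) =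
     (if poly q z = 0 then None else Some (poly p z / poly q z))"
| "rational_map p q None =
     (let n = max (degree p) (degree q)
      in if coeff q n = 0 then None else Some (coeff p n / coeff q n))"

definition is_rational_map_of_degree :: "nat \<Rightarrow> (riemann_sphere \<Rightarrow> riemann_sphere) \<Rightarrow> bool" where
  "is_rational_map_of_degree d f \<longleftrightarrow>
     (\<exists>p q. coprime p q \<and> max (degree p) (degree q) = d \<and> f = rational_map p q)"

text \<open>
  The chart used around a point \<open>x\<close> is \<open>z\<close> if \<open>x\<close> is finite and \<open>1/z\<close> if \<open>x\<close> is infinity.
  Each chart omits one point of the sphere, where the value of \<open>chart_at\<close> is irrelevant.
\<close>

fun chart_at :: "riemann_sphere \<Rightarrow> riemann_sphere \<Rightarrow> complex" where
  "chart_at (Some _) y = the y"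
| "chart_at None y = the (sphere_inverse y)"

fun chart_inv_at :: "riemann_sphere \<Rightarrow> complex \<Rightarrow> riemann_sphere" where
  "chart_inv_at (Some _) z = Some z"
| "chart_inv_at None z = sphere_inverse (Some z)"

definition local_degree :: "(riemann_sphere \<Rightarrow> riemann_sphere) \<Rightarrow> riemann_sphere \<Rightarrow> nat" where
  "local_degree f x =
     nat (zorder (\<lambda>z. chart_at (f x) (f (chart_inv_at x z)) - chart_at (f x) (f x))
            (chart_at x x))"

text \<open>
  For a non-constant rational map all the sets below are finite; \<open>mset_set\<close> would send an
  infinite set to the empty multiset.
\<close>

definition local_degrees_over ::
  "(riemann_sphere \<Rightarrow> riemann_sphere) \<Rightarrow> riemann_sphere \<Rightarrow> nat multiset" where
  "local_degrees_over f x = image_mset (local_degree f) (mset_set (f -` {x}))"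

definition branching_points ::
  "nat \<Rightarrow> (riemann_sphere \<Rightarrow> riemann_sphere) \<Rightarrow> riemann_sphere set" where
  "branching_points d f = {x. local_degrees_over f x \<noteq> replicate_mset d 1}"

definition branching_datum ::
  "nat \<Rightarrow> (riemann_sphere \<Rightarrow> riemann_sphere) \<Rightarrow> nat multiset multiset" where
  "branching_datum d f = image_mset (local_degrees_over f) (mset_set (branching_points d f))"

end

theory Submission imports Defs begin

text \<open>
  Let \<open>y\<^sub>1, y\<^sub>2, y\<^sub>3\<close> be the branching points carrying \<open>\<mu>\<^sub>1, \<mu>\<^sub>2, \<mu>\<^sub>3\<close>. Since every multiplicity
  over \<open>y\<^sub>2\<close> and \<open>y\<^sub>3\<close> is divisible by \<open>r\<close>, the map \<open>f\<close> factors through the \<open>r\<close>-th power map: after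
  a Moebius change of the target sending \<open>y\<^sub>2, y\<^sub>3\<close> to \<open>0, \<infinity>\<close> it becomes \<open>g\<^sup>r\<close> with \<open>g\<close> of
  degree \<open>k\<close>. The power map is unramified away from \<open>0\<close> and \<open>\<infinity>\<close>, so the local degree of
  \<open>f\<close> at a point over \<open>y\<^sub>1\<close> is that of \<open>g\<close>, hence at most \<open>k\<close>. But the \<open>r\<close> points over \<open>y\<^sub>1\<close> have local
  degrees summing to \<open>r * k\<close>, so each of them equals \<open>k\<close>.
  
  The argument is carried out with binary forms. For \<open>f = p/q\<close>, the points over \<open>y\<close> are the zeros of
  the form \<open>F\<^sub>y = p - y q\<close> (or \<open>q\<close>, if \<open>y = \<infinity>\<close>) of degree \<open>d\<close>, and the local degrees are the
  orders of these zeros (\<open>local_degrees_over_eq\<close>). The forms for \<open>y\<^sub>2\<close> and \<open>y\<^sub>3\<close> are \<open>r\<close>-th powers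
  (\<open>poly_is_power\<close>), and the form for \<open>y\<^sub>1\<close> is a linear combination of them, so after rescaling it is
  \<open>P\<^sup>r - Q\<^sup>r\<close> with forms \<open>P\<close> and \<open>Q\<close> of degree \<open>k\<close> without common zero, where \<open>g = P/Q\<close>. That such a form
  has only zeros of order at most \<open>k\<close> is \<open>form_order_power_diff_le\<close>.
\<close>

section \<open>Binary forms on the sphere\<close>

text \<open>
  A polynomial \<open>F\<close> of degree at most \<open>n\<close> is the dehomogenisation of a binary form of degree \<open>n\<close>,
  whose behaviour at infinity depends on \<open>n\<close>: near infinity the form is the
  polynomial with coefficients \<open>coeff F (n - i)\<close>. This makes infinity an ordinary point, at which values
  are still linear and multiplicative and orders still additive.
\<close>

definition form_value :: "nat \<Rightarrow> complex poly \<Rightarrow> riemann_sphere \<Rightarrow> complex" where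
  "form_value n F x = (case x of None \<Rightarrow> coeff F n | Some z \<Rightarrow> poly F z)"

definition form_order :: "nat \<Rightarrow> complex poly \<Rightarrow> riemann_sphere \<Rightarrow> nat" where
  "form_order n F x = (case x of None \<Rightarrow> n - degree F | Some z \<Rightarrow> order z F)"

lemma form_value_diff [simp]: "form_value n (F - G) x = form_value n F x - form_value n G x"
  by (simp add: form_value_def split: option.split)

lemma form_value_smult [simp]: "form_value n (smult c F) x = c * form_value n F x"
  by (simp add: form_value_def split: option.split)

lemma form_value_sum: "form_value n (\<Sum>i\<in>I. F i) x = (\<Sum>i\<in>I. form_value n (F i) x)"
  by (simp add: form_value_def poly_sum coeff_sum split: option.split)

lemma form_value_mult:
  assumes "degree F \<le> m" "degree G \<le> n"
  shows "form_value (m + n) (F * G) x = form_value m F x * form_value n G x"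
proof (cases x)
  case None
  have "coeff (F * G) (m + n) = coeff F m * coeff G n"
  proof (cases "degree F = m \<and> degree G = n")
    case True
    then show ?thesis
      using coeff_mult_degree_sum[of F G] by simp
  next
    case False
    then have "degree F + degree G < m + n"
      using assms by linarith
    then have "degree (F * G) < m + n"
      using degree_mult_le[of F G] by linarith
    then show ?thesis
      using False assms by (auto simp: coeff_eq_0 le_less)
  qed
  with None show ?thesis
    by (simp add: form_value_def)
qed (simp add: form_value_def)

lemma degree_power_le_mult:
  assumes "degree (F :: complex poly) \<le> n"
  shows "degree (F ^ m) \<le> m * n"
  by (metis assms degree_power_le le_trans mult.commute mult_le_mono2)

lemma form_value_power:
  assumes "degree F \<le> n"
  shows "form_value (m * n) (F ^ m) x = form_value n F x ^ m"
proof (induction m)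
  case 0
  then show ?case by (simp add: form_value_def split: option.split)
next
  case (Suc m)
  then show ?case
    using form_value_mult[OF assms degree_power_le_mult[OF assms, of m], of x] by simp
qed

lemma form_value_eq_0_iff:
  assumes "F \<noteq> 0" "degree F \<le> n"
  shows "form_value n F x = 0 \<longleftrightarrow> form_order n F x > 0"
proof (cases x)
  case None
  have "coeff F n = 0 \<longleftrightarrow> degree F < n"
    using assms by (metis coeff_eq_0 leading_coeff_0_iff le_neq_implies_less less_irrefl)
  with None show ?thesis by (simp add: form_value_def form_order_def)
next
  case (Some z)
  then show ?thesis
    using assms order_root[of F z] by (simp add: form_value_def form_order_def)
qed

lemma form_order_le:
  assumes "F \<noteq> 0" "degree F \<le> n"
  shows "form_order n F x \<le> n"
  using order_degree[OF assms(1)] assms(2)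
  by (auto simp: form_order_def split: option.split intro: le_trans)

lemma form_order_mult:
  assumes "F \<noteq> 0" "degree F \<le> m" "G \<noteq> 0" "degree G \<le> n"
  shows "form_order (m + n) (F * G) x = form_order m F x + form_order n G x"
  using assms by (simp add: form_order_def order_mult degree_mult_eq split: option.split)

lemma degree_eq_sum_order:
  assumes "(F :: complex poly) \<noteq> 0"
  shows "(\<Sum>z | poly F z = 0. order z F) = degree F"
proof -
  have "degree F = degree (smult (lead_coeff F) (\<Prod>z | poly F z = 0. [:- z, 1:] ^ order z F))"
    by (simp only: complex_poly_decompose)
  also have "\<dots> = (\<Sum>z | poly F z = 0. degree ([:- z, 1:] ^ order z F))"
    using assms by (simp add: degree_prod_eq_sum_degree)
  also have "\<dots> = (\<Sum>z | poly F z = 0. order z F)"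
    by (simp add: degree_power_eq)
  finally show ?thesis ..
qed

text \<open>
  Counted with multiplicity, a nonzero form of degree \<open>n\<close> has \<open>n\<close> zeros on the sphere: the degree of \<open>F\<close> counts the
  finite ones, and what is missing is by definition the order at infinity.
\<close>

lemma form_zeros:
  assumes "F \<noteq> 0" "degree F \<le> n"
  shows finite_form_zeros: "finite {x. form_value n F x = 0}"
    and sum_form_order: "(\<Sum>x | form_value n F x = 0. form_order n F x) = n"
proof -
  let ?R = "{z. poly F z = 0}"
  have fin: "finite ?R"
    using assms(1) by (rule poly_roots_finite)
  have sub: "{x. form_value n F x = 0} \<subseteq> insert None (Some ` ?R)"
  proof
    fix x assume "x \<in> {x. form_value n F x = 0}"
    then show "x \<in> insert None (Some ` ?R)"
      by (cases x) (auto simp: form_value_def)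
  qed
  then show "finite {x. form_value n F x = 0}"
    using fin by (auto intro: finite_subset)
  have "(\<Sum>x | form_value n F x = 0. form_order n F x) = (\<Sum>x\<in>insert None (Some ` ?R). form_order n F x)"
    using form_value_eq_0_iff[OF assms] fin by (intro sum.mono_neutral_left sub) auto
  also have "\<dots> = (n - degree F) + (\<Sum>z\<in>?R. order z F)"
    using fin by (subst sum.insert) (auto simp: sum.reindex form_order_def)
  also have "\<dots> = n"
    using degree_eq_sum_order[OF assms(1)] assms(2) by simp
  finally show "(\<Sum>x | form_value n F x = 0. form_order n F x) = n" .
qed

section \<open>Fibres and local degrees of a rational map\<close>

text \<open>
  The form whose zeros are the points mapped to \<open>y\<close> by \<open>p/q\<close>.
\<close>

definition fibre_poly :: "complex poly \<Rightarrow> complex poly \<Rightarrow> riemann_sphere \<Rightarrow> complex poly" where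
  "fibre_poly p q y = (case y of None \<Rightarrow> q | Some w \<Rightarrow> p - smult w q)"

text \<open>
  Near \<open>a\<close> the map read in the chart at \<open>y\<close>, minus its value, is the quotient of the fibre
  polynomial by a polynomial that does not vanish at \<open>a\<close>: for finite \<open>y\<close> it is \<open>p/q - y\<close>, and for
  infinite \<open>y\<close> it is \<open>q/p\<close>. This denominator does not affect the order.
\<close>

lemma zorder_chart_rational_map:
  assumes "poly p a \<noteq> 0 \<or> poly q a \<noteq> 0" and "rational_map p q (Some a) = y"
    and "fibre_poly p q y \<noteq> 0"
  shows "zorder (\<lambda>z. chart_at y (rational_map p q (Some z)) - chart_at y y) a
    = int (order a (fibre_poly p q y))"
proof -
  let ?F = "fibre_poly p q y"
  define n where "n = order a ?F"
  obtain H where H: "?F = [:- a, 1:] ^ n * H" "\<not> [:- a, 1:] dvd H"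
    using order_decomp[OF assms(3), of a] unfolding n_def by auto
  have Ha: "poly H a \<noteq> 0"
    using H(2) by (simp add: poly_eq_0_iff_dvd)
  have F: "poly ?F z = (z - a) ^ n * poly H z" for z
    by (subst H(1)) (simp add: poly_power)
  \<comment> \<open>The denominator in the chart at \<open>y\<close>.\<close>
  define v where "v = (case y of None \<Rightarrow> p | Some w \<Rightarrow> q)"
  have va: "poly v a \<noteq> 0"
    using assms(1,2) by (auto simp: v_def split: if_splits)
  have op: "open {z. poly v z \<noteq> 0}"
    by (intro open_Collect_neq continuous_intros)
  show ?thesis
    unfolding n_def[symmetric]
  proof (rule zorder_eqI[OF op])
    show "a \<in> {z. poly v z \<noteq> 0}" using va by simp
    show "(\<lambda>z. poly H z / poly v z) holomorphic_on {z. poly v z \<noteq> 0}"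
      by (intro holomorphic_intros) auto
    show "poly H a / poly v a \<noteq> 0" using Ha va by simp
  next
    fix z assume z: "z \<in> {z. poly v z \<noteq> 0}" "z \<noteq> a"
    show "chart_at y (rational_map p q (Some z)) - chart_at y y
        = poly H z / poly v z * (z - a) powi int n"
    proof (cases y)
      case None
      then show ?thesis
        using z F[of z] by (auto simp: v_def fibre_poly_def)
    next
      case (Some w)
      have "poly p z - w * poly q z = (z - a) ^ n * poly H z"
        using F[of z] Some by (simp add: fibre_poly_def)
      then show ?thesis
        using z Some by (auto simp: v_def field_simps)
    qed
  qed
qed

text \<open>
  The dehomogenisation of the same form of degree \<open>n\<close> at infinity. It reduces the local degree
  at infinity to a local degree at the finite point \<open>0\<close>.
\<close>

definition reversal :: "nat \<Rightarrow> complex poly \<Rightarrow> complex poly" where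
  "reversal n F = monom 1 (n - degree F) * reflect_poly F"

lemma poly_reversal:
  assumes "degree F \<le> n"
  shows "poly (reversal n F) z = (if z = 0 then coeff F n else z ^ n * poly F (1 / z))"
proof (cases "z = 0")
  case True
  show ?thesis
  proof (cases "degree F = n")
    case False
    then show ?thesis using True assms
      by (simp add: reversal_def poly_monom coeff_eq_0)
  qed (use True in \<open>simp add: reversal_def poly_monom\<close>)
next
  case False
  have "z ^ (n - degree F) * z ^ degree F = z ^ n"
    using assms by (simp flip: power_add)
  with False show ?thesis
    by (simp add: reversal_def poly_monom poly_reflect_poly_nz inverse_eq_divide flip: mult.assoc)
qed

lemma order_reversal:
  assumes "F \<noteq> 0"
  shows "order 0 (reversal n F) = n - degree F"
proof -
  have "order 0 (reflect_poly F) = 0"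
    using assms by (intro order_0I) simp
  moreover have "order 0 (monom (1::complex) m) = m" for m
    using order_power_n_n[of "0::complex" m] by (simp add: monom_altdef)
  ultimately show ?thesis
    using assms by (simp add: reversal_def order_mult)
qed

locale rational_quotient =
  fixes p q :: "complex poly" and d :: nat
  assumes coprime: "coprime p q" and degree: "max (degree p) (degree q) = d" and pos: "d > 0"
begin

abbreviation F where "F \<equiv> fibre_poly p q"

lemma degree_le: "degree p \<le> d" "degree q \<le> d" "degree (F y) \<le> d"
  using degree by (auto simp: fibre_poly_def intro!: degree_diff_le split: option.split
      intro: le_trans[OF degree_smult_le])

lemma fibre_poly_nonzero: "F y \<noteq> 0"
proof (cases y)
  case None
  have False if "q = 0"
    using that coprime degree pos dvd_imp_degree_le[of p 1] by auto
  with None show ?thesis by (auto simp: fibre_poly_def)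
next
  case (Some w)
  have False if "p - smult w q = 0"
  proof -
    have p: "p = smult w q" using that by simp
    then have "q dvd p" by (simp add: dvd_smult)
    then have "is_unit q" using coprime by (meson coprime_common_divisor dvd_refl)
    then have "degree q = 0" using dvd_imp_degree_le[of q 1] by auto
    then show False using p degree pos by (simp split: if_splits)
  qed
  with Some show ?thesis by (auto simp: fibre_poly_def)
qed

lemma form_value_not_both_0: "form_value d p x \<noteq> 0 \<or> form_value d q x \<noteq> 0"
proof (cases x)
  case None
  then show ?thesis using degree pos
    by (auto simp: form_value_def max_def split: if_splits)
next
  case (Some z)
  then show ?thesis using coprime coprime_poly_0[of p q z] by (auto simp: form_value_def)
qed

lemma rational_map_eq:
  "rational_map p q x
    = (if form_value d q x = 0 then None else Some (form_value d p x / form_value d q x))"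
  using degree by (cases x) (auto simp: form_value_def Let_def)

lemma rational_map_eq_iff: "rational_map p q x = y \<longleftrightarrow> form_value d (F y) x = 0"
  using form_value_not_both_0[of x]
  by (cases y) (auto simp: rational_map_eq fibre_poly_def field_simps)

lemma local_degree_eq: "local_degree (rational_map p q) x = form_order d (F (rational_map p q x)) x"
proof (cases x)
  case (Some a)
  have "poly p a \<noteq> 0 \<or> poly q a \<noteq> 0"
    using form_value_not_both_0[of x] Some by (simp add: form_value_def)
  from zorder_chart_rational_map[OF this refl fibre_poly_nonzero] show ?thesis
    using Some by (simp add: local_degree_def form_order_def del: rational_map.simps)
next
  case None
  define y where "y = rational_map p q None"
  let ?P = "reversal d p" and ?Q = "reversal d q"
  have val: "poly ?P 0 = form_value d p None" "poly ?Q 0 = form_value d q None"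
    by (simp_all add: poly_reversal degree_le form_value_def)
  have chart: "rational_map p q (chart_inv_at None z) = rational_map ?P ?Q (Some z)" for z
    by (cases "z = 0") (simp_all add: degree form_value_def poly_reversal degree_le)
  have F: "fibre_poly ?P ?Q y = reversal d (F y)"
  proof (cases y)
    case (Some w)
    have "poly (fibre_poly ?P ?Q y) z = poly (reversal d (F y)) z" for z
      using Some degree_le(3)[of "Some w"]
      by (simp add: fibre_poly_def poly_reversal degree_le algebra_simps)
    then show ?thesis by (auto simp: poly_eq_poly_eq_iff[symmetric])
  qed (simp add: fibre_poly_def)
  have ne: "fibre_poly ?P ?Q y \<noteq> 0"
    using fibre_poly_nonzero[of y] unfolding F by (simp add: reversal_def)
  have "rational_map ?P ?Q (Some 0) = y"
    using chart[of 0] by (simp add: y_def)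
  moreover have "poly ?P 0 \<noteq> 0 \<or> poly ?Q 0 \<noteq> 0"
    using form_value_not_both_0[of None] val by simp
  ultimately have "zorder (\<lambda>z. chart_at y (rational_map ?P ?Q (Some z)) - chart_at y y) 0
      = int (d - degree (F y))"
    using zorder_chart_rational_map[of ?P 0 ?Q y] ne by (simp add: F order_reversal fibre_poly_nonzero)
  then show ?thesis
    unfolding local_degree_def None y_def[symmetric] chart by (simp add: form_order_def)
qed

lemma local_degrees_over_eq:
  "local_degrees_over (rational_map p q) y
    = image_mset (form_order d (F y)) (mset_set {x. form_value d (F y) x = 0})"
proof -
  let ?Z = "{x. form_value d (F y) x = 0}"
  have fibre: "rational_map p q -` {y} = ?Z"
    using rational_map_eq_iff by auto
  have "local_degree (rational_map p q) x = form_order d (F y) x" if "x \<in># mset_set ?Z" for x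
  proof -
    have "x \<in> ?Z"
      using that by (simp add: finite_form_zeros fibre_poly_nonzero degree_le)
    then have "rational_map p q x = y"
      by (simp add: rational_map_eq_iff)
    then show ?thesis
      using local_degree_eq[of x] by simp
  qed
  then show ?thesis
    unfolding local_degrees_over_def fibre by (rule image_mset_cong)
qed

lemma sum_local_degrees_over: "sum_mset (local_degrees_over (rational_map p q) y) = d"
  using sum_form_order[OF fibre_poly_nonzero degree_le(3), of y]
  by (simp add: local_degrees_over_eq sum_unfold_sum_mset)

text \<open>
  All fibre forms lie in the pencil spanned by \<open>p\<close> and \<open>q\<close>, and those of two different points are
  linearly independent. Hence any two of them span the pencil, and neither coefficient vanishes
  because the third point differs from both.
\<close>

lemma fibre_poly_linear_combination:
  assumes "y1 \<noteq> y2" "y1 \<noteq> y3" "y2 \<noteq> y3"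
  obtains a b where "a \<noteq> 0" "b \<noteq> 0" "F y1 = smult a (F y2) - smult b (F y3)"
proof -
  have "\<exists>a b. a \<noteq> 0 \<and> b \<noteq> 0 \<and> F y1 = smult a (F y2) - smult b (F y3)"
  proof (cases y1)
    case None
    with assms obtain u v where uv: "y2 = Some u" "y3 = Some v" "u \<noteq> v"
      by (cases y2; cases y3) auto
    have "F y2 - F y3 = smult (v - u) (F y1)"
      unfolding None uv by (intro poly_eqI) (simp add: fibre_poly_def algebra_simps)
    then have "F y1 = smult (1 / (v - u)) (F y2 - F y3)"
      using uv by simp
    then have "F y1 = smult (1 / (v - u)) (F y2) - smult (1 / (v - u)) (F y3)"
      by (simp add: smult_diff_right)
    then show ?thesis using uv by (intro exI[of _ "1 / (v - u)"]) auto
  next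
    case y1: (Some w)
    show ?thesis
    proof (cases y2)
      case None
      with assms y1 obtain v where v: "y3 = Some v" "w \<noteq> v"
        by (cases y3) auto
      then have "F y1 = smult (v - w) (F y2) - smult (-1) (F y3)"
        unfolding None y1 by (intro poly_eqI) (simp add: fibre_poly_def algebra_simps)
      then show ?thesis using v by (intro exI[of _ "v - w"] exI[of _ "-1"]) auto
    next
      case y2: (Some u)
      show ?thesis
      proof (cases y3)
        case None
        have "F y1 = smult 1 (F y2) - smult (w - u) (F y3)"
          unfolding None y1 y2 by (intro poly_eqI) (simp add: fibre_poly_def algebra_simps)
        then show ?thesis using assms y1 y2
          by (intro exI[of _ 1] exI[of _ "w - u"]) auto
      next
        case (Some v)
        then have uv: "u \<noteq> v" "w \<noteq> v" "w \<noteq> u" using assms y1 y2 by auto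
        have "smult (w - v) (F y2) - smult (w - u) (F y3) = smult (u - v) (F y1)"
          unfolding Some y1 y2 by (intro poly_eqI) (simp add: fibre_poly_def algebra_simps)
        then have "F y1 = smult (1 / (u - v)) (smult (w - v) (F y2) - smult (w - u) (F y3))"
          using uv by simp
        then have "F y1 = smult ((w - v) / (u - v)) (F y2) - smult ((w - u) / (u - v)) (F y3)"
          by (simp add: smult_diff_right)
        then show ?thesis using uv
          by (intro exI[of _ "(w - v) / (u - v)"] exI[of _ "(w - u) / (u - v)"]) auto
      qed
    qed
  qed
  then show thesis using that by blast
qed

lemma r_dvd_order_fibre_poly:
  assumes "\<And>n. n \<in># local_degrees_over (rational_map p q) y \<Longrightarrow> r dvd n"
  shows "r dvd order z (F y)"
proof (cases "poly (F y) z = 0")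
  case True
  then have "Some z \<in> {x. form_value d (F y) x = 0}"
    by (simp add: form_value_def)
  then have "form_order d (F y) (Some z) \<in># local_degrees_over (rational_map p q) y"
    by (auto simp: local_degrees_over_eq finite_form_zeros fibre_poly_nonzero degree_le)
  from assms[OF this] show ?thesis by (simp add: form_order_def)
next
  case False
  then show ?thesis by (simp add: order_0I)
qed

end

section \<open>Fibres with multiplicities divisible by a fixed number\<close>

lemma poly_is_power:
  fixes F :: "complex poly"
  assumes "r > 0" "\<And>z. r dvd order z F"
  obtains P where "F = P ^ r"
proof -
  obtain c where c: "c ^ r = lead_coeff F"
    using exists_complex_root[of r "lead_coeff F"] assms(1) by (metis less_irrefl)
  let ?P = "\<lambda>n. \<Prod>z | poly F z = 0. [:- z, 1:] ^ n z"
  have "F = smult (lead_coeff F) (?P (\<lambda>z. order z F))"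
    by (simp only: complex_poly_decompose)
  also have "\<dots> = smult (c ^ r) (?P (\<lambda>z. order z F div r * r))"
    by (simp only: c dvd_div_mult_self[OF assms(2)])
  also have "\<dots> = (smult c (?P (\<lambda>z. order z F div r))) ^ r"
    by (simp add: smult_power prod_power_distrib power_mult)
  finally show thesis using that by blast
qed

text \<open>
  At a zero \<open>x\<close> of \<open>P\<^sup>r - Q\<^sup>r\<close> neither form vanishes, so \<open>P(x) = t Q(x)\<close> for an \<open>r\<close>-th root of
  unity \<open>t\<close>. The factor \<open>P - t Q\<close> of \<open>P\<^sup>r - Q\<^sup>r\<close> is a form of degree \<open>k\<close>, which bounds its order, and the
  cofactor \<open>\<Sum>i<r. P\<^sup>i (t Q)\<^bsup>r-1-i\<^esup>\<close> has at \<open>x\<close> the nonzero value \<open>r P(x)\<^bsup>r-1\<^esup>\<close>. This expresses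
  that the \<open>r\<close>-th power map is unramified at \<open>t\<close>.
\<close>

lemma form_order_power_diff_le:
  assumes "r > 0" and deg: "degree P \<le> k" "degree Q \<le> k"
    and ne: "P ^ r - Q ^ r \<noteq> 0" and nz: "form_value k P x \<noteq> 0 \<or> form_value k Q x \<noteq> 0"
  shows "form_order (r * k) (P ^ r - Q ^ r) x \<le> k"
proof (cases "form_value (r * k) (P ^ r - Q ^ r) x = 0")
  case False
  moreover have "degree (P ^ r - Q ^ r) \<le> r * k"
    using deg by (intro degree_diff_le degree_power_le_mult)
  ultimately show ?thesis
    using form_value_eq_0_iff[OF ne] by simp
next
  case True
  let ?u = "form_value k P x" and ?v = "form_value k Q x"
  have uv: "?u ^ r = ?v ^ r"
    using True deg by (simp add: form_value_power)
  then have v: "?v \<noteq> 0" and u: "?u \<noteq> 0"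
    using nz assms(1) by (auto simp: power_0_left)
  define t where "t = ?u / ?v"
  have t: "t ^ r = 1" "t * ?v = ?u"
    using uv v by (simp_all add: t_def power_divide)
  obtain s where s: "r = Suc s"
    using assms(1) by (cases r) auto
  define R where "R = smult t Q"
  have degR: "degree R \<le> k"
    using deg(2) by (simp add: R_def)
  define S where "S = (\<Sum>i<Suc s. P ^ i * R ^ (s - i))"
  have "R ^ r = Q ^ r"
    by (simp add: R_def t smult_power)
  then have fac: "P ^ r - Q ^ r = (P - R) * S"
    using power_diff_sumr2[of P r R] diff_power_eq_sum[of P s R] by (simp add: S_def s)
  have summand: "form_value (s * k) (P ^ i * R ^ (s - i)) x = ?u ^ s"
    and degsummand: "degree (P ^ i * R ^ (s - i)) \<le> s * k" if "i < Suc s" for i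
  proof -
    have sk: "s * k = i * k + (s - i) * k"
      using that by (simp flip: add_mult_distrib)
    have "form_value (s * k) (P ^ i * R ^ (s - i)) x = ?u ^ i * form_value k R x ^ (s - i)"
      unfolding sk using deg degR by (simp add: form_value_mult form_value_power degree_power_le_mult)
    also have "\<dots> = ?u ^ s"
      using t that by (simp add: R_def flip: power_add)
    finally show "form_value (s * k) (P ^ i * R ^ (s - i)) x = ?u ^ s" .
    show "degree (P ^ i * R ^ (s - i)) \<le> s * k"
      unfolding sk using deg degR
      by (intro order_trans[OF degree_mult_le] add_mono degree_power_le_mult)
  qed
  have degS: "degree S \<le> s * k"
    unfolding S_def using degsummand by (intro degree_sum_le) auto
  have "form_value (s * k) S x = of_nat r * ?u ^ s"
    unfolding S_def form_value_sum using summand by (simp add: s)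
  then have valS: "form_value (s * k) S x \<noteq> 0"
    using u assms(1) by simp
  have ne': "P - R \<noteq> 0" "S \<noteq> 0"
    using ne fac by auto
  have degPR: "degree (P - R) \<le> k"
    using deg degR by (intro degree_diff_le)
  have "form_order (r * k) (P ^ r - Q ^ r) x = form_order k (P - R) x + form_order (s * k) S x"
    unfolding fac using form_order_mult[OF ne'(1) degPR ne'(2) degS, of x] by (simp add: s)
  also have "form_order (s * k) S x = 0"
    using valS form_value_eq_0_iff[OF ne'(2) degS] by simp
  also have "form_order k (P - R) x \<le> k"
    using form_order_le[OF ne'(1) degPR] .
  finally show ?thesis by simp
qed

lemma mset_eq_replicate_of_sum_ge:
  fixes M :: "nat multiset"
  assumes "\<And>a. a \<in># M \<Longrightarrow> a \<le> k" "sum_mset M \<ge> size M * k"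
  shows "M = replicate_mset (size M) k"
  using assms
proof (induction M)
  case (add a M)
  have "sum_mset M \<le> size M * k"
    using sum_mset_mono[of M "\<lambda>a. a" "\<lambda>_. k"] add.prems(1) by simp
  moreover have "a \<le> k" "a + sum_mset M \<ge> k + size M * k"
    using add.prems by simp_all
  ultimately have "a = k" "sum_mset M \<ge> size M * k"
    by linarith+
  with add show ?case
    by simp
qed simp

text \<open>
  The factorisation of the map through the \<open>r\<close>-th power map. The coefficients of the linear combination
  are absorbed into \<open>P\<close> and \<open>Q\<close> by taking complex \<open>r\<close>-th roots. A common zero of \<open>P\<close> and \<open>Q\<close> would be a
  point mapped to both \<open>y2\<close> and \<open>y3\<close>.
\<close>

lemma (in rational_quotient) local_degree_le_of_r_dvd:
  assumes d: "d = r * k" and r: "r > 0"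
    and y: "y1 \<noteq> y2" "y1 \<noteq> y3" "y2 \<noteq> y3"
    and dvd: "\<And>n. n \<in># local_degrees_over (rational_map p q) y2 \<Longrightarrow> r dvd n"
      "\<And>n. n \<in># local_degrees_over (rational_map p q) y3 \<Longrightarrow> r dvd n"
    and n: "n \<in># local_degrees_over (rational_map p q) y1"
  shows "n \<le> k"
proof -
  obtain P0 where P0: "F y2 = P0 ^ r"
    using poly_is_power[OF r] r_dvd_order_fibre_poly[OF dvd(1)] by metis
  obtain Q0 where Q0: "F y3 = Q0 ^ r"
    using poly_is_power[OF r] r_dvd_order_fibre_poly[OF dvd(2)] by metis
  obtain a b where ab: "a \<noteq> 0" "b \<noteq> 0" "F y1 = smult a (F y2) - smult b (F y3)"
    using fibre_poly_linear_combination[OF y] by metis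
  obtain a' b' where root: "a' ^ r = a" "b' ^ r = b"
    using exists_complex_root[of r a] exists_complex_root[of r b] r by (metis less_irrefl)
  define P Q where "P = smult a' P0" and "Q = smult b' Q0"
  have pow: "P ^ r = smult a (F y2)" "Q ^ r = smult b (F y3)"
    by (simp_all add: P_def Q_def P0 Q0 root smult_power)
  have F1: "F y1 = P ^ r - Q ^ r"
    by (simp add: pow ab)
  have deg: "degree P \<le> k" "degree Q \<le> k"
  proof -
    have "P \<noteq> 0" "Q \<noteq> 0"
      using pow ab fibre_poly_nonzero[of y2] fibre_poly_nonzero[of y3] r by (auto simp: zero_power)
    then have "r * degree P = degree (F y2)" "r * degree Q = degree (F y3)"
      using degree_power_eq[of P r] degree_power_eq[of Q r] pow ab by simp_all
    then show "degree P \<le> k" "degree Q \<le> k"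
      using degree_le(3)[of y2] degree_le(3)[of y3] d r by (metis nat_mult_le_cancel1)+
  qed
  obtain x where x: "n = form_order d (F y1) x"
    using n by (auto simp: local_degrees_over_eq)
  have "form_value k P x \<noteq> 0 \<or> form_value k Q x \<noteq> 0"
  proof (rule ccontr)
    assume "\<not> ?thesis"
    then have "form_value d (P ^ r) x = 0" "form_value d (Q ^ r) x = 0"
      using deg r by (simp_all add: d form_value_power)
    then have "rational_map p q x = y2" "rational_map p q x = y3"
      using ab by (simp_all add: pow rational_map_eq_iff)
    then show False using y by simp
  qed
  then show ?thesis
    using form_order_power_diff_le[OF r deg] fibre_poly_nonzero[of y1] by (simp add: x F1 d)
qed

theorem corollary1p3:
  fixes r k d :: nat
    and f :: "riemann_sphere \<Rightarrow> riemann_sphere"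
    and \<mu>\<^sub>1 \<mu>\<^sub>2 \<mu>\<^sub>3 xs ys :: "nat multiset"
  assumes "r \<ge> 2" and "k \<ge> 2" and "d = r * k"
    and "is_rational_map_of_degree d f"
    and "card (branching_points d f) = 3"
    and "branching_datum d f = {#\<mu>\<^sub>1, \<mu>\<^sub>2, \<mu>\<^sub>3#}"
    and "\<forall>a \<in># \<mu>\<^sub>1. a > 0"
    and "\<forall>x \<in># xs. x > 0" and "\<mu>\<^sub>2 = {#r * x. x \<in># xs#}"
    and "\<forall>y \<in># ys. y > 0" and "\<mu>\<^sub>3 = {#r * y. y \<in># ys#}"
    and "size \<mu>\<^sub>1 = r"
  shows "\<mu>\<^sub>1 = replicate_mset r k"
proof -
  obtain p q where pq: "coprime p q" "max (degree p) (degree q) = d" and f: "f = rational_map p q"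
    using assms(4) by (auto simp: is_rational_map_of_degree_def)
  interpret rational_quotient p q d
    using pq assms(1-3) by unfold_locales auto
  let ?B = "branching_points d f"
  have "image_mset (local_degrees_over f) (mset_set ?B) = {#\<mu>\<^sub>1, \<mu>\<^sub>2, \<mu>\<^sub>3#}"
    using assms(6) by (simp add: branching_datum_def)
  then obtain y1 y2 y3 where B: "mset_set ?B = {#y1, y2, y3#}"
    and \<mu>: "\<mu>\<^sub>1 = local_degrees_over f y1" "\<mu>\<^sub>2 = local_degrees_over f y2"
      "\<mu>\<^sub>3 = local_degrees_over f y3"
    by (auto dest!: msed_map_invR)
  \<comment> \<open>The partitions may coincide, but the points carrying them are distinct.\<close>
  have "count (mset_set ?B) y \<le> 1" for y
    by (cases "finite ?B") (simp_all add: count_mset_set')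
  from this[of y1] this[of y2] have y: "y1 \<noteq> y2" "y1 \<noteq> y3" "y2 \<noteq> y3"
    unfolding B by (auto split: if_splits)
  have "a \<le> k" if "a \<in># \<mu>\<^sub>1" for a
  proof (rule local_degree_le_of_r_dvd[OF assms(3) _ y])
    show "r > 0" using assms(1) by simp
    show "r dvd n" if "n \<in># local_degrees_over (rational_map p q) y2" for n
      using that assms(9) unfolding \<mu> f by auto
    show "r dvd n" if "n \<in># local_degrees_over (rational_map p q) y3" for n
      using that assms(11) unfolding \<mu> f by auto
    show "a \<in># local_degrees_over (rational_map p q) y1"
      using that by (simp add: \<mu> f)
  qed
  moreover have "sum_mset \<mu>\<^sub>1 = size \<mu>\<^sub>1 * k"
    using sum_local_degrees_over[of y1] assms(3,12) by (simp add: \<mu> f)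
  ultimately show ?thesis
    using mset_eq_replicate_of_sum_ge[of \<mu>\<^sub>1 k] assms(12) by simp
qed

end
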